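(* Let $(\varphi_n)_{n\ge 1}$ be an orthonormal system on $[0,1]$ with $$\int_0^1 \varphi_n(x)\,dx = 0,\qquad n=1,2,\dots,$$ and let $(d_k)_{k\ge1}$ be a bounded sequence of positive numbers. For $\varepsilon=(\varepsilon_n)\in\Delta$ and $N\ge 1$ put $$Q_N(x,\varepsilon)=\sum_{k=1}^{N} d_k\,k^{1/2}\varphi_k(x)\,\varepsilon_k,\qquad D_N(\varepsilon)=\frac1N\sum_{i=1}^{N-1}\left|\int_0^{i/N}Q_N(x,\varepsilon)\,dx\right| .$$ If for every $\varepsilon\in\Delta$ one has $D_N(\varepsilon)=O(1)$ as $N\to\infty$, then $(d_k)$ is an absolute convergence factor for the class $Lip1$, i.e. $$\sum_{k=1}^\infty |c_k(f)|\,k^{1/2}d_k<+\infty\qquad\text{for all } f\in Lip1 .$$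
   Context: All functions are real-valued. An orthonormal system $(\varphi_n)_{n\ge1}$ on $[0,1]$ (ONS) is a sequence in $L_2(0,1)$ with $\int_0^1\varphi_n\varphi_m\,dx=\delta_{nm}$; it is not assumed complete. For $f\in L_2(0,1)$, the Fourier coefficients are $c_n(f)=\int_0^1 f(x)\varphi_n(x)\,dx$. $Lip1$ is the class of functions $f:[0,1]\to\mathbb{R}$ for which there is a constant $M$ (depending on $f$) with $|f(x)-f(y)|\le M|x-y|$ for all $x,y\in[0,1]$. $\Delta$ is the set of all sequences $\varepsilon=(\varepsilon_n)_{n\ge1}$ with $\varepsilon_n\in\{-1,0,1\}$ for every $n$. A bounded sequence of positive numbers $(d_k)$ is an absolute convergence factor (with respect to $(\varphi_n)$) for a function class $E$ if $\sum_{k=1}^\infty|c_k(f)|k^{1/2}d_k<+\infty$ for all $f\in E$. The condition $D_N(\varepsilon)=O(1)$ for each $\varepsilon\in\Delta$ means: for each $\varepsilon\in\Delta$, $\sup_N D_N(\varepsilon)<\infty$ (the bound is allowed to depend on $\varepsilon$). *)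

theory Defs
  imports "HOL-Analysis.Analysis"
begin

text \<open>Sequences indexed by $n \ge 1$ are functions on \<^typ>\<open>nat\<close> whose value at 0 is never
  constrained and never used. Functions on $[0,1]$ are functions on \<^typ>\<open>real\<close> whose values
  outside $[0,1]$ are irrelevant.\<close>

definition square_integrable :: "(real \<Rightarrow> real) \<Rightarrow> bool" where
  "square_integrable f \<longleftrightarrow>
     set_borel_measurable lebesgue {0..1} f \<and>
     set_integrable lebesgue {0..1} (\<lambda>x. (f x)\<^sup>2)"

definition orthonormal_system :: "(nat \<Rightarrow> real \<Rightarrow> real) \<Rightarrow> bool" where
  "orthonormal_system \<phi> \<longleftrightarrow>
     (\<forall>n\<ge>1. square_integrable (\<phi> n)) \<and>
     (\<forall>n\<ge>1. \<forall>m\<ge>1. (LINT x:{0..1}|lebesgue. \<phi> n x * \<phi> m x) = (if n = m then 1 else 0))"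

definition fourier_coeff :: "(nat \<Rightarrow> real \<Rightarrow> real) \<Rightarrow> (real \<Rightarrow> real) \<Rightarrow> nat \<Rightarrow> real" where
  "fourier_coeff \<phi> f n = (LINT x:{0..1}|lebesgue. f x * \<phi> n x)"

definition Lip1 :: "(real \<Rightarrow> real) set" where
  "Lip1 = {f. \<exists>M. M-lipschitz_on {0..1} f}"

definition Delta :: "(nat \<Rightarrow> real) set" where
  "Delta = {\<epsilon>. \<forall>n\<ge>1. \<epsilon> n \<in> {-1, 0, 1}}"

definition bounded_positive_seq :: "(nat \<Rightarrow> real) \<Rightarrow> bool" where
  "bounded_positive_seq d \<longleftrightarrow> (\<forall>k\<ge>1. 0 < d k) \<and> bounded (d ` {1..})"

definition absolute_convergence_factor ::
  "(nat \<Rightarrow> real \<Rightarrow> real) \<Rightarrow> (real \<Rightarrow> real) set \<Rightarrow> (nat \<Rightarrow> real) \<Rightarrow> bool" where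
  "absolute_convergence_factor \<phi> E d \<longleftrightarrow>
     bounded_positive_seq d \<and>
     (\<forall>f\<in>E. summable (\<lambda>k. \<bar>fourier_coeff \<phi> f (Suc k)\<bar> * sqrt (real (Suc k)) * d (Suc k)))"

definition Q ::
  "(nat \<Rightarrow> real \<Rightarrow> real) \<Rightarrow> (nat \<Rightarrow> real) \<Rightarrow> nat \<Rightarrow> real \<Rightarrow> (nat \<Rightarrow> real) \<Rightarrow> real" where
  "Q \<phi> d N x \<epsilon> = (\<Sum>k=1..N. d k * sqrt (real k) * \<phi> k x * \<epsilon> k)"

definition D ::
  "(nat \<Rightarrow> real \<Rightarrow> real) \<Rightarrow> (nat \<Rightarrow> real) \<Rightarrow> nat \<Rightarrow> (nat \<Rightarrow> real) \<Rightarrow> real" where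
  "D \<phi> d N \<epsilon> =
     1 / real N * (\<Sum>i=1..<N. \<bar>LINT x:{0..real i / real N}|lebesgue. Q \<phi> d N x \<epsilon>\<bar>)"

end

theory Submission
  imports Defs
begin

text \<open>Choosing \<open>\<epsilon>\<^sub>k = sgn (c\<^sub>k f)\<close>, the \<open>N\<close>-th partial sum of the series equals the integral
  of \<open>f Q\<^sub>N\<close>. Abel summation over the grid \<open>i/N\<close> bounds this integral, for an \<open>M\<close>-Lipschitz \<open>f\<close>,
  by \<open>M D\<^sub>N(\<epsilon>) + (M/N) \<integral>\<bar>Q\<^sub>N\<bar>\<close>. As \<open>\<bar>d\<^sub>k\<bar> \<le> B\<close>, orthonormality gives
  \<open>\<integral>Q\<^sub>N\<^sup>2 = \<Sum>k\<le>N. k d\<^sub>k\<^sup>2 \<le> B\<^sup>2N\<^sup>2\<close>, so \<open>\<integral>\<bar>Q\<^sub>N\<bar> = O(N)\<close> and the partial sums stay bounded.\<close>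

text \<open>Pointwise domination by \<open>f\<^sup>2 + g\<^sup>2\<close>. This makes every product
  \<open>f * \<phi> k\<close> and \<open>\<phi> k * \<phi> l\<close> integrable, so the integrals of
  finite sums below may be split.\<close>

lemma square_integrable_mult:
  assumes "square_integrable f" "square_integrable g"
  shows "set_integrable lebesgue {0..1} (\<lambda>x. f x * g x)"
proof (rule set_integrable_bound)
  show "set_integrable lebesgue {0..1} (\<lambda>x. (f x)\<^sup>2 + (g x)\<^sup>2)"
    using assms by (auto simp: square_integrable_def intro: set_integral_add)
  \<comment> \<open>Only the functions cut off to the unit interval are known to be measurable.
    Multiplying them leaves a single indicator, which is idempotent.\<close>
  have "(\<lambda>x. (indicator {0..1} x *\<^sub>R f x) * (indicator {0..1} x *\<^sub>R g x)) \<in> borel_measurable lebesgue"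
    using assms unfolding square_integrable_def set_borel_measurable_def
    by (intro borel_measurable_times) auto
  also have "(\<lambda>x. (indicator {0..1} x *\<^sub>R f x) * (indicator {0..1} x *\<^sub>R g x))
      = (\<lambda>x. indicator {0..1} x *\<^sub>R (f x * g x))"
    by (auto simp: indicator_def)
  finally show "set_borel_measurable lebesgue {0..1} (\<lambda>x. f x * g x)"
    by (simp add: set_borel_measurable_def)
  have "\<bar>a * b\<bar> \<le> a\<^sup>2 + b\<^sup>2" for a b :: real
    using zero_le_power2[of "\<bar>a\<bar> - \<bar>b\<bar>"] sum_power2_ge_zero[of a b]
    unfolding power2_diff abs_mult power2_abs by linarith
  then show "AE x in lebesgue. x \<in> {0..1} \<longrightarrow> norm (f x * g x) \<le> norm ((f x)\<^sup>2 + (g x)\<^sup>2)"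
    by simp
qed

lemma square_integrable_continuous:
  fixes f :: "real \<Rightarrow> real"
  assumes "continuous_on {0..1} f"
  shows "square_integrable f"
proof -
  have "set_borel_measurable borel {0..1} f"
    unfolding set_borel_measurable_def
    by (intro borel_measurable_continuous_on_indicator assms) auto
  then have "set_borel_measurable lebesgue {0..1} f"
    unfolding set_borel_measurable_def by (intro measurable_completion) simp
  moreover have "(\<lambda>x. (f x)\<^sup>2) absolutely_integrable_on cbox 0 1"
    by (intro absolutely_integrable_continuous continuous_intros) (use assms in simp)
  ultimately show ?thesis
    by (simp add: square_integrable_def)
qed

text \<open>On a set of finite measure L2 lies in L1: the constant 1 is itself square integrable and
  serves as the second factor.\<close>

lemma square_integrable_imp_set_integrable:
  assumes "square_integrable f"
  shows "set_integrable lebesgue {0..1} f"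
  using square_integrable_mult[OF assms square_integrable_continuous[of "\<lambda>_. 1"]] by simp

lemma set_integral_sum:
  fixes f :: "'i \<Rightarrow> 'a \<Rightarrow> 'b::{banach, second_countable_topology}"
  assumes "\<And>i. i \<in> I \<Longrightarrow> set_integrable M A (f i)"
  shows "set_integrable M A (\<lambda>x. \<Sum>i\<in>I. f i x)"
    and "(LINT x:A|M. \<Sum>i\<in>I. f i x) = (\<Sum>i\<in>I. LINT x:A|M. f i x)"
  using assms unfolding set_integrable_def set_lebesgue_integral_def
  by (auto simp: scaleR_sum_right)

lemma set_lebesgue_integral_singleton:
  fixes g :: "real \<Rightarrow> real"
  shows "set_lebesgue_integral lebesgue {a} g = 0"
  by (subst set_integral_at_point) (auto intro: absolutely_integrable_negligible)

lemma set_lebesgue_integral_split: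
  fixes g :: "real \<Rightarrow> real"
  assumes "set_integrable lebesgue {a..c} g" "a \<le> b" "b \<le> c"
  shows "(LINT x:{a..c}|lebesgue. g x) = (LINT x:{a..b}|lebesgue. g x) + (LINT x:{b..c}|lebesgue. g x)"
proof -
  have i: "set_integrable lebesgue {a..b} g" "set_integrable lebesgue {b..c} g"
    using assms by (auto intro: set_integrable_subset)
  have "{a..c} = {a..b} \<union> {b..c}"
    using assms by auto
  \<comment> \<open>The two closed intervals overlap in the endpoint \<open>b\<close>, so they are
    disjoint only up to a null set.\<close>
  moreover have "AE x in lebesgue. \<not> (x \<in> {a..b} \<and> x \<in> {b..c})"
  proof (rule AE_I'[of "{b}"])
    show "{b} \<in> null_sets lebesgue" by simp
  qed auto
  ultimately show ?thesis
    using set_integral_Un_AE[OF _ _ _ i] by simp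
qed

text \<open>Stated for the initial segment \<open>[0, m/N]\<close> so that the Abel summation becomes an
  induction on \<open>m\<close>.\<close>

lemma lipschitz_integral_Abel:
  fixes f q :: "real \<Rightarrow> real"
  assumes lip: "M-lipschitz_on {0..1} f" and q: "set_integrable lebesgue {0..1} q"
    and fq: "set_integrable lebesgue {0..1} (\<lambda>x. f x * q x)" and m: "m \<le> N" and N: "N \<ge> 1"
  shows "\<bar>(LINT x:{0..real m / N}|lebesgue. f x * q x) - f (real m / N) * (LINT x:{0..real m / N}|lebesgue. q x)\<bar>
    \<le> M / N * ((LINT x:{0..real m / N}|lebesgue. \<bar>q x\<bar>) + (\<Sum>i=1..<m. \<bar>LINT x:{0..real i / N}|lebesgue. q x\<bar>))"
  using m
proof (induction m)
  case 0
  show ?case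
    by (simp add: set_lebesgue_integral_singleton)
next
  case (Suc m)
  define s t where "s = real m / N" and "t = real (Suc m) / N"
  have st: "0 \<le> s" "s \<le> t" "t \<le> 1" and ts: "t - s = 1 / N"
    using Suc.prems N by (auto simp: s_def t_def field_simps)
  have M: "0 \<le> M"
    using lip by (rule lipschitz_on_nonneg)
  \<comment> \<open>Oscillation of \<open>f\<close> on one grid cell of length \<open>1 / N\<close>;
    it controls both error terms \<open>piece\<close> and \<open>jump\<close>.\<close>
  have lip': "\<bar>f x - f y\<bar> \<le> M / N" if "x \<in> {s..t}" "y \<in> {s..t}" for x y
  proof -
    have "\<bar>f x - f y\<bar> \<le> M * \<bar>x - y\<bar>"
      using lipschitz_onD[OF lip, of x y] that st by (auto simp: dist_real_def)
    also have "\<dots> \<le> M * (1 / N)"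
      using that ts M by (intro mult_left_mono) auto
    finally show ?thesis by simp
  qed
  define F where "F = (\<lambda>a. LINT x:{0..a}|lebesgue. q x)"
  define S where "S = (\<Sum>i=1..<m. \<bar>F (real i / N)\<bar>)"
  have sub: "set_integrable lebesgue {a..b} g"
    if "set_integrable lebesgue {0..1} g" "0 \<le> a" "b \<le> 1" for a b and g :: "real \<Rightarrow> real"
    by (rule set_integrable_subset[OF that(1)]) (use that in auto)
  have aq: "set_integrable lebesgue {0..1} (\<lambda>x. \<bar>q x\<bar>)"
    using q by (rule set_integrable_abs)
  have split: "(LINT x:{0..t}|lebesgue. g x) = (LINT x:{0..s}|lebesgue. g x) + (LINT x:{s..t}|lebesgue. g x)"
    if "set_integrable lebesgue {0..1} g" for g :: "real \<Rightarrow> real"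
    using st by (intro set_lebesgue_integral_split sub[OF that]) auto
  \<comment> \<open>Cost of freezing \<open>f\<close> at its right endpoint value on the new
    cell.\<close>
  have piece: "\<bar>(LINT x:{s..t}|lebesgue. f x * q x) - f t * (LINT x:{s..t}|lebesgue. q x)\<bar>
      \<le> M / N * (LINT x:{s..t}|lebesgue. \<bar>q x\<bar>)"
  proof -
    have i1: "set_integrable lebesgue {s..t} (\<lambda>x. f x * q x)"
      and i2: "set_integrable lebesgue {s..t} (\<lambda>x. f t * q x)"
      and i3: "set_integrable lebesgue {s..t} (\<lambda>x. M / N * \<bar>q x\<bar>)"
      by (rule sub[OF fq] sub[OF set_integrable_mult_right[OF q]] sub[OF set_integrable_mult_right[OF aq]];
          use st in simp)+
    have i4: "set_integrable lebesgue {s..t} (\<lambda>x. f x * q x - f t * q x)"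
      by (rule set_integral_diff(1)[OF i1 i2])
    have "(LINT x:{s..t}|lebesgue. f x * q x) - f t * (LINT x:{s..t}|lebesgue. q x)
        = (LINT x:{s..t}|lebesgue. f x * q x - f t * q x)"
      by (simp add: set_integral_diff(2)[OF i1 i2])
    also have "\<bar>\<dots>\<bar> \<le> (LINT x:{s..t}|lebesgue. \<bar>f x * q x - f t * q x\<bar>)"
      using set_integral_norm_bound[OF i4] by simp
    also have "\<dots> \<le> (LINT x:{s..t}|lebesgue. M / N * \<bar>q x\<bar>)"
    proof (rule set_integral_mono[OF set_integrable_abs[OF i4] i3])
      fix x assume "x \<in> {s..t}"
      then have "\<bar>f x - f t\<bar> * \<bar>q x\<bar> \<le> M / N * \<bar>q x\<bar>"
        using lip'[of x t] st by (intro mult_right_mono) auto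
      then show "\<bar>f x * q x - f t * q x\<bar> \<le> M / N * \<bar>q x\<bar>"
        by (simp flip: left_diff_distrib abs_mult)
    qed
    finally show ?thesis by simp
  qed
  have jump: "\<bar>(f s - f t) * F s\<bar> \<le> M / N * \<bar>F s\<bar>"
    unfolding abs_mult using lip'[of s t] st by (intro mult_right_mono) auto
  \<comment> \<open>The sum starts at 1, so for \<open>m = 0\<close> nothing is appended and
    \<open>F 0\<close> has to vanish.\<close>
  have sum: "S + \<bar>F s\<bar> = (\<Sum>i=1..<Suc m. \<bar>F (real i / N)\<bar>)"
  proof (cases "m = 0")
    case True
    have "F 0 = 0"
      by (simp add: F_def set_lebesgue_integral_singleton)
    then show ?thesis
      using True by (simp add: S_def s_def)
  qed (simp add: S_def s_def)
  have IH: "\<bar>(LINT x:{0..s}|lebesgue. f x * q x) - f s * F s\<bar> \<le> M / N * ((LINT x:{0..s}|lebesgue. \<bar>q x\<bar>) + S)"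
    using Suc by (simp add: s_def F_def S_def)
  have "(LINT x:{0..t}|lebesgue. f x * q x) - f t * F t
      = ((LINT x:{0..s}|lebesgue. f x * q x) - f s * F s)
        + ((LINT x:{s..t}|lebesgue. f x * q x) - f t * (LINT x:{s..t}|lebesgue. q x))
        + (f s - f t) * F s"
    unfolding F_def split[OF q] split[OF fq] by (simp add: algebra_simps)
  then have "\<bar>(LINT x:{0..t}|lebesgue. f x * q x) - f t * F t\<bar>
      \<le> M / N * ((LINT x:{0..s}|lebesgue. \<bar>q x\<bar>) + S) + M / N * (LINT x:{s..t}|lebesgue. \<bar>q x\<bar>) + M / N * \<bar>F s\<bar>"
    using IH piece jump by linarith
  also have "\<dots> = M / N * ((LINT x:{0..t}|lebesgue. \<bar>q x\<bar>) + (S + \<bar>F s\<bar>))"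
    unfolding split[OF aq] by (simp only: distrib_left add.assoc add.left_commute)
  finally show ?case
    unfolding sum unfolding F_def t_def .
qed

text \<open>Pythagoras: the square expands into a finite double sum, of which orthonormality keeps
  only the diagonal.\<close>

lemma orthonormal_system_integral_square:
  assumes "orthonormal_system \<phi>"
  shows "(LINT x:{0..1}|lebesgue. (\<Sum>k=1..N. a k * \<phi> k x)\<^sup>2) = (\<Sum>k=1..N. (a k)\<^sup>2)"
    and "set_integrable lebesgue {0..1} (\<lambda>x. (\<Sum>k=1..N. a k * \<phi> k x)\<^sup>2)"
proof -
  have i: "set_integrable lebesgue {0..1} (\<lambda>x. a k * a l * (\<phi> k x * \<phi> l x))"
    if "k \<in> {1..N}" "l \<in> {1..N}" for k l
    using assms that by (intro set_integrable_mult_right square_integrable_mult) (auto simp: orthonormal_system_def)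
  have eq: "(\<lambda>x. (\<Sum>k=1..N. a k * \<phi> k x)\<^sup>2) = (\<lambda>x. \<Sum>k=1..N. \<Sum>l=1..N. a k * a l * (\<phi> k x * \<phi> l x))"
    by (simp add: power2_eq_square sum_product mult_ac)
  show "set_integrable lebesgue {0..1} (\<lambda>x. (\<Sum>k=1..N. a k * \<phi> k x)\<^sup>2)"
    unfolding eq by (intro set_integral_sum(1) i) auto
  have "(LINT x:{0..1}|lebesgue. (\<Sum>k=1..N. a k * \<phi> k x)\<^sup>2)
      = (\<Sum>k=1..N. \<Sum>l=1..N. a k * a l * (LINT x:{0..1}|lebesgue. \<phi> k x * \<phi> l x))"
    unfolding eq
  proof (subst set_integral_sum(2))
    show "set_integrable lebesgue {0..1} (\<lambda>x. \<Sum>l=1..N. a k * a l * (\<phi> k x * \<phi> l x))" if "k \<in> {1..N}" for k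
      using that by (intro set_integral_sum(1) i) auto
    show "(\<Sum>k=1..N. LINT x:{0..1}|lebesgue. \<Sum>l=1..N. a k * a l * (\<phi> k x * \<phi> l x))
        = (\<Sum>k=1..N. \<Sum>l=1..N. a k * a l * (LINT x:{0..1}|lebesgue. \<phi> k x * \<phi> l x))"
    proof (intro sum.cong refl)
      fix k assume "k \<in> {1..N}"
      then show "(LINT x:{0..1}|lebesgue. \<Sum>l=1..N. a k * a l * (\<phi> k x * \<phi> l x))
          = (\<Sum>l=1..N. a k * a l * (LINT x:{0..1}|lebesgue. \<phi> k x * \<phi> l x))"
        by (subst set_integral_sum(2)) (auto intro: i)
    qed
  qed
  also have "\<dots> = (\<Sum>k=1..N. \<Sum>l=1..N. if k = l then (a k)\<^sup>2 else 0)"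
    using assms by (intro sum.cong) (auto simp: orthonormal_system_def power2_eq_square)
  also have "\<dots> = (\<Sum>k=1..N. (a k)\<^sup>2)"
    by (intro sum.cong) (auto simp: sum.delta)
  finally show "(LINT x:{0..1}|lebesgue. (\<Sum>k=1..N. a k * \<phi> k x)\<^sup>2) = (\<Sum>k=1..N. (a k)\<^sup>2)" .
qed

text \<open>A substitute for Cauchy-Schwarz: integrate
  \<open>2 * c * \<bar>q x\<bar> \<le> (q x)\<^sup>2 + c\<^sup>2\<close>, dropping the factor 2. The
  free \<open>c\<close> is later set to \<open>N\<close>, the order of the L2 norm of
  \<open>q\<close>, so that both terms are O(N).\<close>

lemma integral_abs_le_integral_square:
  fixes q :: "real \<Rightarrow> real"
  assumes q: "set_integrable lebesgue {0..1} q" and q2: "set_integrable lebesgue {0..1} (\<lambda>x. (q x)\<^sup>2)"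
    and c: "c > 0"
  shows "(LINT x:{0..1}|lebesgue. \<bar>q x\<bar>) \<le> (LINT x:{0..1}|lebesgue. (q x)\<^sup>2) / c + c"
proof -
  have i: "set_integrable lebesgue {0..1} (\<lambda>x. (q x)\<^sup>2 / c)"
    using q2 by (simp add: set_integrable_divide)
  have ic: "set_integrable lebesgue {0..1} (\<lambda>_::real. c)"
    by (intro square_integrable_imp_set_integrable square_integrable_continuous continuous_on_const)
  have "(LINT x:{0..1}|lebesgue. \<bar>q x\<bar>) \<le> (LINT x:{0..1}|lebesgue. (q x)\<^sup>2 / c + c)"
  proof (rule set_integral_mono[OF set_integrable_abs[OF q] set_integral_add(1)[OF i ic]])
    fix x
    have "2 * (c * \<bar>q x\<bar>) \<le> (q x)\<^sup>2 + c\<^sup>2"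
      using zero_le_power2[of "\<bar>q x\<bar> - c"] by (simp add: power2_diff algebra_simps)
    moreover have "0 \<le> c * \<bar>q x\<bar>"
      using c by simp
    ultimately have "c * \<bar>q x\<bar> \<le> (q x)\<^sup>2 + c\<^sup>2"
      by linarith
    then show "\<bar>q x\<bar> \<le> (q x)\<^sup>2 / c + c"
      using c by (simp add: field_simps power2_eq_square)
  qed
  also have "\<dots> = (LINT x:{0..1}|lebesgue. (q x)\<^sup>2) / c + c"
    by (subst set_integral_add(2)[OF i ic]) (simp add: set_integral_const)
  finally show ?thesis .
qed

theorem theorem5:
  fixes \<phi> :: "nat \<Rightarrow> real \<Rightarrow> real" and d :: "nat \<Rightarrow> real"
  assumes "orthonormal_system \<phi>"
    and "\<And>n. n \<ge> 1 \<Longrightarrow> (LINT x:{0..1}|lebesgue. \<phi> n x) = 0"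
    and "bounded_positive_seq d"
    and "\<And>\<epsilon>. \<epsilon> \<in> Delta \<Longrightarrow> bdd_above ((\<lambda>N. D \<phi> d N \<epsilon>) ` {1..})"
  shows "absolute_convergence_factor \<phi> Lip1 d"
  unfolding absolute_convergence_factor_def
proof (intro conjI ballI)
  show "bounded_positive_seq d" by fact
  obtain B where B: "\<And>k. k \<ge> 1 \<Longrightarrow> \<bar>d k\<bar> \<le> B"
    using assms(3) by (auto simp: bounded_positive_seq_def bounded_iff)
  have sq: "square_integrable (\<phi> k)" if "k \<ge> 1" for k
    using assms(1) that by (simp add: orthonormal_system_def)
  fix f assume "f \<in> Lip1"
  then obtain M where lip: "M-lipschitz_on {0..1} f"
    by (auto simp: Lip1_def)
  have M: "0 \<le> M"
    using lip by (rule lipschitz_on_nonneg)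
  have sqf: "square_integrable f"
    using lip by (intro square_integrable_continuous lipschitz_on_continuous_on)
  \<comment> \<open>These signs do not depend on \<open>N\<close>. A single use of the hypothesis
    therefore gives one constant \<open>K\<close> for all partial sums.\<close>
  define \<epsilon> where "\<epsilon> = (\<lambda>k. sgn (fourier_coeff \<phi> f k))"
  have \<epsilon>: "\<epsilon> \<in> Delta"
    by (auto simp: Delta_def \<epsilon>_def sgn_if)
  obtain K where K: "\<And>N. N \<ge> 1 \<Longrightarrow> D \<phi> d N \<epsilon> \<le> K"
    using assms(4)[OF \<epsilon>] by (auto simp: bdd_above_def)
  define a where "a = (\<lambda>k. d k * sqrt (real k) * \<epsilon> k)"
  have Q: "Q \<phi> d N x \<epsilon> = (\<Sum>k=1..N. a k * \<phi> k x)" for N x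
    by (simp add: Q_def a_def mult_ac)
  have \<phi>: "set_integrable lebesgue {0..1} (\<lambda>x. a k * \<phi> k x)" if "k \<in> {1..N}" for k N
    using that by (intro set_integrable_mult_right square_integrable_imp_set_integrable sq) auto
  have f\<phi>: "set_integrable lebesgue {0..1} (\<lambda>x. a k * (f x * \<phi> k x))" if "k \<in> {1..N}" for k N
    using that by (intro set_integrable_mult_right square_integrable_mult sq sqf) auto
  have bound: "(\<Sum>k=1..N. \<bar>fourier_coeff \<phi> f k\<bar> * sqrt (real k) * d k) \<le> M * (B\<^sup>2 + 1 + K)"
    if N: "N \<ge> 1" for N
  proof -
    define q where "q = (\<lambda>x. Q \<phi> d N x \<epsilon>)"
    have q: "set_integrable lebesgue {0..1} q"
      unfolding q_def Q by (intro set_integral_sum(1) \<phi>) auto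
    have fq_eq: "(\<lambda>x. f x * q x) = (\<lambda>x. \<Sum>k=1..N. a k * (f x * \<phi> k x))"
      by (simp add: q_def Q sum_distrib_left mult_ac)
    have fq: "set_integrable lebesgue {0..1} (\<lambda>x. f x * q x)"
      unfolding fq_eq by (intro set_integral_sum(1) f\<phi>) auto
    have "(LINT x:{0..1}|lebesgue. f x * q x) = (\<Sum>k=1..N. a k * fourier_coeff \<phi> f k)"
      unfolding fq_eq by (subst set_integral_sum(2)) (auto simp: fourier_coeff_def intro!: f\<phi>)
    also have "\<dots> = (\<Sum>k=1..N. \<bar>fourier_coeff \<phi> f k\<bar> * sqrt (real k) * d k)"
      by (intro sum.cong) (auto simp: a_def \<epsilon>_def abs_sgn mult_ac)
    finally have partial: "(\<Sum>k=1..N. \<bar>fourier_coeff \<phi> f k\<bar> * sqrt (real k) * d k)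
        = (LINT x:{0..1}|lebesgue. f x * q x)" ..
    \<comment> \<open>The zero means of the \<open>\<phi> k\<close> remove the boundary term
      \<open>f 1\<close> times the integral of \<open>q\<close> from the Abel summation.\<close>
    have q0: "(LINT x:{0..1}|lebesgue. q x) = 0"
      unfolding q_def Q by (subst set_integral_sum(2)) (auto simp: assms(2) intro!: \<phi>)
    have q2: "set_integrable lebesgue {0..1} (\<lambda>x. (q x)\<^sup>2)"
      unfolding q_def Q by (rule orthonormal_system_integral_square(2)[OF assms(1)])
    have "(LINT x:{0..1}|lebesgue. (q x)\<^sup>2) = (\<Sum>k=1..N. (a k)\<^sup>2)"
      unfolding q_def Q by (rule orthonormal_system_integral_square(1)[OF assms(1)])
    \<comment> \<open>Squaring turns the weight \<open>sqrt (real k)\<close> into \<open>k\<close>,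
      at most \<open>N\<close>; summing \<open>N\<close> such terms gives
      \<open>B\<^sup>2 * N\<^sup>2\<close>.\<close>
    also have "\<dots> \<le> (\<Sum>k=1..N. B\<^sup>2 * real N)"
    proof (intro sum_mono)
      fix k assume k: "k \<in> {1..N}"
      have "(d k)\<^sup>2 \<le> B\<^sup>2"
        using B[of k] k by (intro power2_le_iff_abs_le[THEN iffD2]) auto
      moreover have "(\<epsilon> k)\<^sup>2 \<le> 1"
        by (simp add: \<epsilon>_def sgn_if)
      ultimately have "(d k)\<^sup>2 * real k * (\<epsilon> k)\<^sup>2 \<le> B\<^sup>2 * real N * 1"
        using k by (intro mult_mono) auto
      then show "(a k)\<^sup>2 \<le> B\<^sup>2 * real N"
        by (simp add: a_def power_mult_distrib)
    qed
    finally have "(LINT x:{0..1}|lebesgue. (q x)\<^sup>2) / N \<le> B\<^sup>2 * N"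
      using N by (simp add: field_simps)
    then have "(LINT x:{0..1}|lebesgue. \<bar>q x\<bar>) \<le> (B\<^sup>2 + 1) * N"
      using integral_abs_le_integral_square[OF q q2, of N] N by (simp add: algebra_simps)
    then have L1: "M / N * (LINT x:{0..1}|lebesgue. \<bar>q x\<bar>) \<le> M * (B\<^sup>2 + 1)"
      using mult_left_mono[of "LINT x:{0..1}|lebesgue. \<bar>q x\<bar>" "(B\<^sup>2 + 1) * N" "M / N"] M N by simp
    \<comment> \<open>The Abel estimate at \<open>m = N\<close>, where the initial segment is the
      whole interval.\<close>
    have "(LINT x:{0..1}|lebesgue. f x * q x)
        \<le> M / N * ((LINT x:{0..1}|lebesgue. \<bar>q x\<bar>) + (\<Sum>i=1..<N. \<bar>LINT x:{0..real i / N}|lebesgue. q x\<bar>))"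
      using lipschitz_integral_Abel[OF lip q fq order_refl N] N q0 by simp
    \<comment> \<open>The factor \<open>1 / N\<close> from the mesh is exactly the normalisation in
      \<open>D\<close>.\<close>
    also have "\<dots> = M / N * (LINT x:{0..1}|lebesgue. \<bar>q x\<bar>) + M * D \<phi> d N \<epsilon>"
      by (simp add: D_def q_def distrib_left)
    also have "\<dots> \<le> M * (B\<^sup>2 + 1) + M * K"
      by (intro add_mono L1 mult_left_mono K N M)
    finally show ?thesis
      unfolding partial by (simp add: distrib_left)
  qed
  show "summable (\<lambda>k. \<bar>fourier_coeff \<phi> f (Suc k)\<bar> * sqrt (real (Suc k)) * d (Suc k))"
  proof (rule summableI_nonneg_bounded)
    show "0 \<le> \<bar>fourier_coeff \<phi> f (Suc k)\<bar> * sqrt (real (Suc k)) * d (Suc k)" for k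
      using assms(3) by (auto simp: bounded_positive_seq_def less_imp_le)
    show "(\<Sum>k<n. \<bar>fourier_coeff \<phi> f (Suc k)\<bar> * sqrt (real (Suc k)) * d (Suc k)) \<le> M * (B\<^sup>2 + 1 + K)" for n
    proof -
      \<comment> \<open>\<open>bound\<close> requires \<open>N \<ge> 1\<close>, so one nonnegative
        term is added; this also covers \<open>n = 0\<close>. The index is then shifted to start at
        1.\<close>
      have "(\<Sum>k<n. \<bar>fourier_coeff \<phi> f (Suc k)\<bar> * sqrt (real (Suc k)) * d (Suc k))
          \<le> (\<Sum>k<Suc n. \<bar>fourier_coeff \<phi> f (Suc k)\<bar> * sqrt (real (Suc k)) * d (Suc k))"
        using assms(3) by (auto simp: bounded_positive_seq_def less_imp_le)
      also have "\<dots> = (\<Sum>k=1..Suc n. \<bar>fourier_coeff \<phi> f k\<bar> * sqrt (real k) * d k)"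
        unfolding One_nat_def sum.shift_bounds_cl_Suc_ivl by (simp only: lessThan_Suc_atMost atLeast0AtMost)
      also have "\<dots> \<le> M * (B\<^sup>2 + 1 + K)"
        by (rule bound) simp
      finally show ?thesis .
    qed
  qed
qed

end
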